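(* Let $W$ be a real random variable with $\mathsf E W=0$, $\mathsf E W^2=1$ and $\mathsf E|W|^3<\infty$, and let $W^*$ be a random variable having the $W$-zero biased distribution. Then $$\zeta_1(W,W^* )\le\frac12\,\mathsf E|W|^3,$$ with equality when $W$ has a 2-point distribution.
   Context: Zero bias: for a zero-mean random variable $W$ with variance $\sigma^2>0$, a random variable $W^*$ is said to have the $W$-zero biased distribution if $\mathsf E\,Wf(W)=\sigma^2\,\mathsf E f'(W^* )$ for every differentiable $f:\mathbb R\to\mathbb R$ such that the left-hand side is defined. It is known that such a distribution exists and has density $p(w)=\sigma^{-2}\mathsf E(W\mathbf 1\{W>w\})$ for $w\ge0$ and $p(w)=\sigma^{-2}\mathsf E(-W\mathbf 1\{W<w\})$ for $w<0$. The metric $\zeta_1$: for $f\in C(\mathbb R)$ let $M_1(f):=\sup_{x\ne y}\left|\frac{f(x)-f(y)}{x-y}\right|$, and $M_1(f)=\infty$ if $f\notin C(\mathbb R)$. Let $\mathcal F_1$ be the set of all real bounded functions on $\mathbb R$ with $M_1(f)\le1$. Then $\zeta_1(X,Y):=\sup\{|\mathsf Ef(X)-\mathsf Ef(Y)|: f\in\mathcal F_1\}$; it depends only on the distributions of $X$ and $Y$. *)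

theory Defs
  imports "HOL-Probability.Probability"
begin

(* The identity is required for those differentiable f for which both expectations exist as
   Lebesgue integrals. Integrability of W f(W) alone does not imply that of f'(V): for W with
   P(W = 1) = P(W = -1) = 1/2 the zero biased distribution is uniform on [-1, 1], and the derivative
   of f(x) = x + x^2 sin (1 / x^2), f(0) = 0, is not Lebesgue integrable there, while E W f(W) = 1. As
   the Bochner integral of a non-integrable function is 0 by convention, asking for the identity without the
   second integrability premise would leave no zero biased distribution for such W. *)

definition zero_biased ::
  "'a measure \<Rightarrow> ('a \<Rightarrow> real) \<Rightarrow> 'b measure \<Rightarrow> ('b \<Rightarrow> real) \<Rightarrow> bool" where
  "zero_biased M W N V \<longleftrightarrow>
     prob_space M \<and> W \<in> borel_measurable M \<and>
     integrable M (\<lambda>x. (W x)\<^sup>2) \<and> (LINT x|M. W x) = 0 \<and> (LINT x|M. (W x)\<^sup>2) > 0 \<and>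
     prob_space N \<and> V \<in> borel_measurable N \<and>
     (\<forall>f :: real \<Rightarrow> real.
        f differentiable_on UNIV \<longrightarrow>
        integrable M (\<lambda>x. W x * f (W x)) \<longrightarrow>
        integrable N (\<lambda>y. deriv f (V y)) \<longrightarrow>
        (LINT x|M. W x * f (W x)) = (LINT x|M. (W x)\<^sup>2) * (LINT y|N. deriv f (V y)))"

definition M1 :: "(real \<Rightarrow> real) \<Rightarrow> ereal" where
  "M1 f = (if continuous_on UNIV f
           then SUP (x, y) \<in> {(x, y). x \<noteq> y}. ereal \<bar>(f x - f y) / (x - y)\<bar>
           else \<infinity>)"

definition F1 :: "(real \<Rightarrow> real) set" where
  "F1 = {f. bounded (range f) \<and> M1 f \<le> 1}"

definition zeta1 ::
  "'a measure \<Rightarrow> ('a \<Rightarrow> real) \<Rightarrow> 'b measure \<Rightarrow> ('b \<Rightarrow> real) \<Rightarrow> ereal" where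
  "zeta1 M X N Y = (SUP f \<in> F1. ereal \<bar>(LINT x|M. f (X x)) - (LINT y|N. f (Y y))\<bar>)"

definition two_point_distribution :: "'a measure \<Rightarrow> ('a \<Rightarrow> real) \<Rightarrow> bool" where
  "two_point_distribution M X \<longleftrightarrow>
     (\<exists>a b. a \<noteq> b \<and>
        measure M {x \<in> space M. X x = a} > 0 \<and> measure M {x \<in> space M. X x = b} > 0 \<and>
        (AE x in M. X x = a \<or> X x = b))"

end

theory Submission
  imports Defs
begin

text \<open>
  With \<open>F' = f\<close>, zero biasing gives \<open>E f(W) - E f(W*) = E (f(W) - W F(W))\<close>. So it suffices to find,
  for a \<open>1\<close>-Lipschitz \<open>f\<close> with \<open>f 0 = F 0 = 0\<close>, multipliers \<open>s\<close>, \<open>a\<close> of the constraints \<open>E W\<^sup>2 = 1\<close>, \<open>E W = 0\<close>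
  with \<open>f w - w F w \<le> \<bar>w\<bar>\<^sup>3 / 2 + s (w\<^sup>2 - 1) + a w\<close> for all \<open>w\<close>. Put \<open>M t = (t + f t) / 2\<close> on the positive
  half line and the same for \<open>f (- t)\<close> on the negative one; both are nondecreasing and
  \<open>1\<close>-Lipschitz. With \<open>T x = M x / x - \<integral>\<^sub>0\<^sup>x M\<close> and its counterpart \<open>S\<close> the inequality becomes
  \<open>T x + S y + s ((x - 1/x) + (y - 1/y)) \<le> 1\<close> for all \<open>x, y > 0\<close>. Such an \<open>s\<close> exists once
  \<open>\<lambda> T x + \<mu> T x' + \<nu> S y + \<rho> S y' \<le> 1\<close> for weights with \<open>\<lambda> + \<mu> = \<nu> + \<rho> = 1\<close> balancing the gaps, and
  it is enough that one of the pairs is a single point. Then the other pair is replaced by the point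
  \<open>1/x\<close> and the function on its side by the linear interpolation there, which reduces everything to \<open>x y = 1\<close>.

  For a two-point law on \<open>{a, - b}\<close> (so \<open>a b = 1\<close>) the distance is attained by \<open>\<bar>x - (a - b)\<bar>\<close>, truncated.
\<close>

section \<open>The balanced case \<open>x * y = 1\<close> and the gap function\<close>

text \<open>With \<open>1 / x = y\<close>, the larger of \<open>x\<close>, \<open>y\<close>
  multiplies the variable with the smaller range \<open>[0, a]\<close>. That term increases up to
  \<open>a\<close>, where it is \<open>1 - a^2 / 2\<close>; the other term is at most
  \<open>a^2 / 2\<close>.\<close>

lemma square_gap_le_1:
  fixes u v x y :: real
  assumes "0 < x" "x * y = 1" "0 \<le> u" "u \<le> x" "0 \<le> v" "v \<le> y"
  shows "u / x - u\<^sup>2 / 2 + (v / y - v\<^sup>2 / 2) \<le> 1"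
proof -
  have "0 < y" using assms(1,2) zero_less_mult_pos[of x y] by simp
  have main: "p * b - p\<^sup>2 / 2 + (q * a - q\<^sup>2 / 2) \<le> 1"
    if "0 < a" "a \<le> b" "a * b = 1" "0 \<le> p" "p \<le> a" for a b p q :: real
  proof -
    have "0 \<le> (a - p) * (2 * b - a - p)" using that by (intro mult_nonneg_nonneg) auto
    moreover have "0 \<le> (a - q)\<^sup>2" by simp
    ultimately show ?thesis using \<open>a * b = 1\<close> by (simp add: power2_eq_square algebra_simps)
  qed
  have inv: "1 / x = y" "1 / y = x" using assms(1,2) \<open>0 < y\<close> by (auto simp: field_simps)
  have "u / x = u * y" "v / y = v * x" using inv by (metis times_divide_eq_right mult.right_neutral)+
  moreover have "x \<le> y \<Longrightarrow> u * y - u\<^sup>2 / 2 + (v * x - v\<^sup>2 / 2) \<le> 1"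
    using main[of x y u v] assms by simp
  moreover have "y \<le> x \<Longrightarrow> v * x - v\<^sup>2 / 2 + (u * y - u\<^sup>2 / 2) \<le> 1"
    using main[of y x v u] assms \<open>0 < y\<close> by (simp add: mult.commute)
  ultimately show ?thesis by linarith
qed

text \<open>This is \<open>(x^2 - 1) / x\<close>, the coefficient of the multiplier \<open>s\<close>
  after division by \<open>x\<close>. For positive arguments
  \<open>recip_gap x + recip_gap y\<close> has the sign of \<open>x * y - 1\<close>.\<close>

definition recip_gap :: "real \<Rightarrow> real" where "recip_gap x = x - 1 / x"

lemma recip_gap_less_iff: "0 < x \<Longrightarrow> 0 < y \<Longrightarrow> recip_gap x < recip_gap y \<longleftrightarrow> x < y"
  using frac_less2[of 1 1 x y] frac_less2[of 1 1 y x]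
  by (cases x y rule: linorder_cases) (auto simp: recip_gap_def)

lemma recip_gap_le_iff: "0 < x \<Longrightarrow> 0 < y \<Longrightarrow> recip_gap x \<le> recip_gap y \<longleftrightarrow> x \<le> y"
  using recip_gap_less_iff by (meson not_le)

lemma recip_gap_inverse: "recip_gap (1 / x) = - recip_gap x"
  by (simp add: recip_gap_def)

section \<open>Primitives of nondecreasing \<open>1\<close>-Lipschitz functions\<close>

locale unit_slope =
  fixes M I :: "real \<Rightarrow> real"
  assumes M_0: "M 0 = 0" and I_0: "I 0 = 0"
    and M_mono: "\<And>x y. x \<le> y \<Longrightarrow> M x \<le> M y"
    and M_lip: "\<And>x y. x \<le> y \<Longrightarrow> M y \<le> M x + (y - x)"
    and I_deriv: "\<And>x. (I has_real_derivative M x) (at x)"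
begin

definition T :: "real \<Rightarrow> real" where "T x = M x / x - I x"

text \<open>On \<open>[x, y]\<close> the graph of \<open>M\<close> lies above the constant
  \<open>M x\<close> and above the line of slope \<open>1\<close> ending at \<open>(y, M y)\<close>.
  The lower bound is the area under the larger of the two.\<close>

lemma I_diff_ge:
  assumes "x \<le> y"
  shows "M x * (y - x) + (M y - M x)\<^sup>2 / 2 \<le> I y - I x"
proof -
  \<comment> \<open>Here the line of slope \<open>1\<close> through \<open>(y, M y)\<close> takes
    the value \<open>M x\<close>.\<close>
  define c where "c = y - (M y - M x)"
  have c: "x \<le> c" "c \<le> y" using M_mono[OF assms] M_lip[OF assms] by (auto simp: c_def)
  have "I x - M x * x \<le> I c - M x * c"
    by (rule DERIV_nonneg_imp_nondecreasing[OF c(1)])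
       (auto intro!: exI derivative_eq_intros I_deriv M_mono)
  moreover have "I c - (M y - y) * c - c\<^sup>2 / 2 \<le> I y - (M y - y) * y - y\<^sup>2 / 2"
  proof (rule DERIV_nonneg_imp_nondecreasing[OF c(2)])
    fix t assume "c \<le> t" "t \<le> y"
    have "((\<lambda>t. I t - (M y - y) * t - t\<^sup>2 / 2) has_real_derivative M t - (M y - y) - t) (at t)"
      by (auto intro!: derivative_eq_intros I_deriv)
    moreover have "0 \<le> M t - (M y - y) - t" using M_lip[OF \<open>t \<le> y\<close>] by simp
    ultimately show "\<exists>d. ((\<lambda>t. I t - (M y - y) * t - t\<^sup>2 / 2) has_real_derivative d) (at t) \<and> 0 \<le> d"
      by blast
  qed
  ultimately show ?thesis unfolding c_def power2_eq_square by (simp add: field_simps)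
qed

lemma M_bounds: "0 \<le> x \<Longrightarrow> 0 \<le> M x" "0 \<le> x \<Longrightarrow> M x \<le> x"
  using M_mono[of 0 x] M_lip[of 0 x] by (auto simp: M_0)

lemma T_le: "0 < x \<Longrightarrow> T x \<le> M x / x - (M x)\<^sup>2 / 2"
  using I_diff_ge[of 0 x] by (simp add: T_def M_0 I_0)

text \<open>The witness \<open>v\<close> is the linear interpolation of \<open>M\<close> at \<open>y\<close>.\<close>

lemma T_convex_combination_le:
  fixes p q :: real
  assumes "0 < a" "a < b" "0 \<le> p" "0 \<le> q" "p + q = 1" "0 < y"
    and y: "recip_gap y = p * recip_gap a + q * recip_gap b"
  obtains v where "0 \<le> v" "v \<le> y" "p * T a + q * T b \<le> v / y - v\<^sup>2 / 2"
proof -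
  define d where "d = M b - M a"
  \<comment> \<open>\<open>r\<close> locates \<open>y\<close> between \<open>a\<close> and
    \<open>b\<close>, while \<open>q\<close> locates \<open>recip_gap y\<close> between the gaps of
    the ends. Concavity of \<open>recip_gap\<close> makes \<open>r \<le> q\<close>.\<close>
  define r where "r = (y - a) / (b - a)"
  have b: "0 < b" using assms by simp
  have p: "p = 1 - q" using assms by simp
  have y_eqs: "recip_gap y = recip_gap a + q * (recip_gap b - recip_gap a)"
      "recip_gap y = recip_gap b - p * (recip_gap b - recip_gap a)"
    unfolding y p by (simp_all add: algebra_simps)
  have "recip_gap a < recip_gap b" using assms b by (simp add: recip_gap_less_iff)
  then have "0 \<le> q * (recip_gap b - recip_gap a)" "0 \<le> p * (recip_gap b - recip_gap a)"
    using assms by auto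
  then have "recip_gap a \<le> recip_gap y" "recip_gap y \<le> recip_gap b"
    using y_eqs by linarith+
  then have ay: "a \<le> y" "y \<le> b"
    using recip_gap_le_iff assms(1,6) b by blast+
  have r: "0 \<le> r" "r \<le> 1" using ay assms by (auto simp: r_def)
  have d: "0 \<le> d" "d \<le> b - a" using M_mono[of a b] M_lip[of a b] assms by (auto simp: d_def)
  have rb: "r * (b - a) = y - a" using assms by (simp add: r_def)
  have "r * d \<le> r * (b - a)" using d r by (intro mult_left_mono) auto
  then have rd: "r * d \<le> y - a" using rb by simp
  have Ma: "0 \<le> M a" "M a \<le> a" using M_bounds assms by auto
  have q_eq: "q * (b - a) * (1 + 1 / (a * b)) = (y - a) * (1 + 1 / (a * y))"
  proof -
    have gap: "recip_gap t - recip_gap a = (t - a) * (1 + 1 / (a * t))" if "0 < t" for t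
      using that assms by (simp add: recip_gap_def field_simps)
    have "q * (recip_gap b - recip_gap a) = recip_gap y - recip_gap a"
      using y_eqs(1) by simp
    then show ?thesis using gap[of b] gap[of y] assms b by simp
  qed
  have "(q * (1 + 1 / (a * b))) * (b - a) = (r * (1 + 1 / (a * y))) * (b - a)"
    using q_eq rb by (metis mult.assoc mult.commute)
  then have "q * (1 + 1 / (a * b)) = r * (1 + 1 / (a * y))"
    using assms by simp
  then have "a * (q * (a * b + 1) * y) = a * (r * (a * y + 1) * b)"
    using assms b by (simp add: field_simps)
  then have q_b: "q * (a * b + 1) * y = r * (a * y + 1) * b"
    using assms(1) by simp
  have qr: "r \<le> q"
  proof -
    have "(a * b + 1) * y \<le> (a * y + 1) * b" using ay by (simp add: algebra_simps)
    then have "r * ((a * b + 1) * y) \<le> q * ((a * b + 1) * y)"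
      using q_b r(1) by (smt (verit) mult.assoc mult_left_mono)
    moreover have "0 < (a * b + 1) * y" using assms b by (simp add: add_pos_pos)
    ultimately show ?thesis by (rule mult_right_le_imp_le)
  qed
  have qb: "q / b \<le> r / y"
  proof -
    have "q * y * (a * b + 1) = r * b * (a * y + 1)" using q_b by (simp add: algebra_simps)
    also have "\<dots> \<le> r * b * (a * b + 1)"
      using r b ay assms by (intro mult_left_mono) auto
    finally have "q * y \<le> r * b" using assms b by (simp add: add_pos_pos)
    then show ?thesis using assms b by (simp add: field_simps)
  qed
  \<comment> \<open>The linear term is controlled by \<open>q / b \<le> r / y\<close>, the quadratic
    one by \<open>r * r \<le> r \<le> q\<close>.\<close>
  have gap: "q * (d / b - d\<^sup>2 / 2) \<le> r * d / y - (r * d)\<^sup>2 / 2"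
  proof -
    have "d * (q / b) \<le> d * (r / y)" using qb d by (intro mult_left_mono)
    moreover have "r * r \<le> q" using r qr by (smt (verit) mult_left_le)
    then have "d\<^sup>2 * (r * r) \<le> d\<^sup>2 * q" by (intro mult_left_mono) auto
    ultimately show ?thesis by (simp add: power2_eq_square algebra_simps)
  qed
  define v where "v = M a + r * d"
  have "p * T a + q * T b
      = M a * (p / a + q / b) + q * d / b - I a - q * (I b - I a)"
    by (simp add: T_def d_def p diff_divide_distrib algebra_simps)
  also have "\<dots> \<le> M a * (p / a + q / b) + q * d / b - (M a)\<^sup>2 / 2 - q * (M a * (b - a) + d\<^sup>2 / 2)"
    using mult_left_mono[OF I_diff_ge[of a b] \<open>0 \<le> q\<close>] I_diff_ge[of 0 a] assms
    by (simp add: d_def M_0 I_0)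
  also have "\<dots> = M a * (p / a + q / b - q * (b - a)) - (M a)\<^sup>2 / 2 + q * (d / b - d\<^sup>2 / 2)"
    by (simp add: algebra_simps)
  \<comment> \<open>The balance of the gaps simplifies the coefficient of \<open>M a\<close>. Then
    \<open>r * d \<le> y - a\<close> supplies the cross term of \<open>v^2\<close>.\<close>
  also have "p / a + q / b - q * (b - a) = a - y + 1 / y"
    using y unfolding p by (simp add: recip_gap_def algebra_simps diff_divide_distrib)
  also have "M a * (a - y + 1 / y) - (M a)\<^sup>2 / 2 + q * (d / b - d\<^sup>2 / 2)
      \<le> M a * (1 / y - r * d) - (M a)\<^sup>2 / 2 + (r * d / y - (r * d)\<^sup>2 / 2)"
    using gap mult_left_mono[of "a - y + 1 / y" "1 / y - r * d" "M a"] rd Ma by linarith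
  also have "\<dots> = v / y - v\<^sup>2 / 2"
    by (simp add: v_def power2_eq_square algebra_simps add_divide_distrib)
  finally have "p * T a + q * T b \<le> v / y - v\<^sup>2 / 2" .
  moreover have "0 \<le> v" "v \<le> y" using Ma r d rd by (auto simp: v_def)
  ultimately show ?thesis using that by blast
qed

end

section \<open>Existence of the multiplier of the variance constraint\<close>

text \<open>Normalised, the coefficients are weights \<open>p\<close>, \<open>q\<close> for which
  the gaps at \<open>a\<close> and \<open>b\<close> average to the gap at \<open>1 / x\<close>.
  Interpolation replaces the pair by the single point \<open>1 / x\<close>, where
  \<open>square_gap_le_1\<close> applies.\<close>

lemma three_point:
  assumes "unit_slope M I" "unit_slope N J"
    and pos: "0 < x" "0 < a" "0 < b"
    and da: "recip_gap x + recip_gap a \<le> 0" and db: "0 \<le> recip_gap x + recip_gap b"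
  shows "(recip_gap x + recip_gap b) * (unit_slope.T M I x + unit_slope.T N J a - 1)
       - (recip_gap x + recip_gap a) * (unit_slope.T M I x + unit_slope.T N J b - 1) \<le> 0"
    (is "?e * (?Tx + ?Sa - 1) - ?d * (?Tx + ?Sb - 1) \<le> 0")
proof -
  interpret M: unit_slope M I by fact
  interpret N: unit_slope N J by fact
  show ?thesis
  proof (cases "a < b")
    case False
    have "recip_gap b \<le> recip_gap a" using False pos by (simp add: recip_gap_le_iff)
    then have "?d = 0" "?e = 0" using da db by linarith+
    then show ?thesis by simp
  next
    case True
    have "recip_gap a < recip_gap b" using True pos by (simp add: recip_gap_less_iff)
    then have D: "0 < ?e - ?d" by simp
    define p where "p = ?e / (?e - ?d)"
    define q where "q = - ?d / (?e - ?d)"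
    have pq: "0 \<le> p" "0 \<le> q" using da db D by (auto simp: p_def q_def)
    have sum: "p + q = 1" using D by (simp add: p_def q_def add_divide_distrib[symmetric])
    have pD: "p * (?e - ?d) = ?e" "q * (?e - ?d) = - ?d" using D by (auto simp: p_def q_def)
    have "(p * ?d + q * ?e) * (?e - ?d) = (p * (?e - ?d)) * ?d + (q * (?e - ?d)) * ?e"
      by (simp add: algebra_simps)
    also have "\<dots> = 0" unfolding pD by (simp add: algebra_simps)
    finally have "p * ?d + q * ?e = 0" using D by simp
    then have "(p + q) * (recip_gap x) + (p * recip_gap a + q * recip_gap b) = 0"
      by (simp add: algebra_simps)
    then have "recip_gap (1 / x) = p * recip_gap a + q * recip_gap b"
      unfolding sum recip_gap_inverse by simp
    then obtain v where v: "0 \<le> v" "v \<le> 1 / x" "p * N.T a + q * N.T b \<le> v / (1 / x) - v\<^sup>2 / 2"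
      using N.T_convex_combination_le[of a b p q "1 / x"] pq sum pos True
      by (metis zero_less_divide_1_iff)
    have "M.T x + (p * N.T a + q * N.T b) \<le> 1"
      using square_gap_le_1[of x "1 / x" "M x" v] M.T_le[of x] M.M_bounds[of x] v pos by simp
    moreover have "p * (?Tx + ?Sa - 1) + q * (?Tx + ?Sb - 1) = (p + q) * (?Tx - 1) + (p * ?Sa + q * ?Sb)"
      by (simp add: algebra_simps)
    ultimately have "p * (?Tx + ?Sa - 1) + q * (?Tx + ?Sb - 1) \<le> 0"
      using sum by simp
    then have "(p * (?Tx + ?Sa - 1) + q * (?Tx + ?Sb - 1)) * (?e - ?d) \<le> 0"
      using D by (simp add: mult_nonpos_nonneg)
    then have "(p * (?e - ?d)) * (?Tx + ?Sa - 1) + (q * (?e - ?d)) * (?Tx + ?Sb - 1) \<le> 0"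
      by (simp add: algebra_simps)
    then show ?thesis unfolding pD mult_minus_left by linarith
  qed
qed


text \<open>Exchanging partners gives the mixed pairs \<open>(x', y)\<close> and
  \<open>(x, y')\<close>. Whatever the signs of their gaps, the claim is, up to a positive factor, a
  nonnegative combination of two instances of \<open>three_point\<close>.\<close>

lemma four_point:
  assumes "unit_slope M I" "unit_slope N J"
    and pos: "0 < x" "0 < x'" "0 < y" "0 < y'"
    and d: "recip_gap x + recip_gap y < 0" "0 < recip_gap x' + recip_gap y'"
  shows "(recip_gap x' + recip_gap y') * (unit_slope.T M I x + unit_slope.T N J y - 1)
       - (recip_gap x + recip_gap y) * (unit_slope.T M I x' + unit_slope.T N J y' - 1) \<le> 0"
proof -
  have combine: "(u' + v') * (p + q - 1) - (u + v) * (p' + q' - 1) \<le> 0"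
    if uv: "u + v < 0" "0 < u' + v'"
      and a: "0 \<le> u' + v \<Longrightarrow> (u' + v) * (p + q - 1) - (u + v) * (p' + q - 1) \<le> 0"
      and b: "u' + v \<le> 0 \<Longrightarrow> (u' + v') * (p' + q - 1) - (u' + v) * (p' + q' - 1) \<le> 0"
      and c: "0 \<le> u + v' \<Longrightarrow> (u + v') * (p + q - 1) - (u + v) * (p + q' - 1) \<le> 0"
      and e: "u + v' \<le> 0 \<Longrightarrow> (u' + v') * (p + q' - 1) - (u + v') * (p' + q' - 1) \<le> 0"
    for u v u' v' p q p' q' :: real
  proof -
    define H where "H = (u' + v') * (p + q - 1) - (u + v) * (p' + q' - 1)"
    \<comment> \<open>For mixed pairs of opposite sign the factor \<open>k\<close> is
      \<open>u' - u\<close> or \<open>v' - v\<close>; it is positive, being a nonnegative mixed gap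
      minus the negative gap \<open>u + v\<close>.\<close>
    have mixed: "0 < k \<Longrightarrow> k * H = (u' + v') * A + - (u + v) * B \<Longrightarrow> A \<le> 0 \<Longrightarrow> B \<le> 0 \<Longrightarrow> H \<le> 0"
      for k A B :: real
      using uv by (smt (verit) mult_nonneg_nonpos zero_less_mult_iff)
    consider "0 \<le> u' + v" "0 \<le> u + v'" | "u' + v \<le> 0" "u + v' \<le> 0"
      | "0 \<le> u' + v" "u + v' \<le> 0" | "u' + v \<le> 0" "0 \<le> u + v'" by linarith
    then have "H \<le> 0"
    proof cases
      case 1
      then show ?thesis using a c unfolding H_def by (simp add: algebra_simps)
    next
      case 2
      then show ?thesis using b e unfolding H_def by (simp add: algebra_simps)
    next
      case 3
      show ?thesis
        by (rule mixed[OF _ _ a[OF 3(1)] e[OF 3(2)], of "u' - u"])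
           (use uv 3 in \<open>auto simp: H_def algebra_simps\<close>)
    next
      case 4
      show ?thesis
        by (rule mixed[OF _ _ c[OF 4(2)] b[OF 4(1)], of "v' - v"])
           (use uv 4 in \<open>auto simp: H_def algebra_simps\<close>)
    qed
    then show ?thesis by (simp add: H_def)
  qed
  show ?thesis
  proof (rule combine[OF d])
    assume "0 \<le> recip_gap x' + recip_gap y"
    then show "(recip_gap x' + recip_gap y) * (unit_slope.T M I x + unit_slope.T N J y - 1)
       - (recip_gap x + recip_gap y) * (unit_slope.T M I x' + unit_slope.T N J y - 1) \<le> 0"
      using three_point[OF assms(2,1), of y x x'] pos d by (simp add: add.commute)
  next
    assume "recip_gap x' + recip_gap y \<le> 0"
    then show "(recip_gap x' + recip_gap y') * (unit_slope.T M I x' + unit_slope.T N J y - 1)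
       - (recip_gap x' + recip_gap y) * (unit_slope.T M I x' + unit_slope.T N J y' - 1) \<le> 0"
      using three_point[OF assms(1,2), of x' y y'] pos d by simp
  next
    assume "0 \<le> recip_gap x + recip_gap y'"
    then show "(recip_gap x + recip_gap y') * (unit_slope.T M I x + unit_slope.T N J y - 1)
       - (recip_gap x + recip_gap y) * (unit_slope.T M I x + unit_slope.T N J y' - 1) \<le> 0"
      using three_point[OF assms(1,2), of x y y'] pos d by simp
  next
    assume "recip_gap x + recip_gap y' \<le> 0"
    then show "(recip_gap x' + recip_gap y') * (unit_slope.T M I x + unit_slope.T N J y' - 1)
       - (recip_gap x + recip_gap y') * (unit_slope.T M I x' + unit_slope.T N J y' - 1) \<le> 0"
      using three_point[OF assms(2,1), of y' x x'] pos d by (simp add: add.commute)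
  qed
qed

text \<open>Pairs with negative gap bound \<open>s\<close> from below, pairs with positive gap from
  above. By \<open>four_point\<close> each lower bound is at most each upper bound, so the supremum
  of the lower bounds serves. A zero gap means \<open>x * y = 1\<close>, where \<open>s\<close>
  drops out.\<close>

lemma multiplier_exists:
  assumes "unit_slope M I" "unit_slope N J"
  obtains s where "\<And>x y. 0 < x \<Longrightarrow> 0 < y \<Longrightarrow>
    unit_slope.T M I x + unit_slope.T N J y - 1 + s * (recip_gap x + recip_gap y) \<le> 0"
proof -
  define h where "h x y = unit_slope.T M I x + unit_slope.T N J y - 1" for x y
  define d where "d x y = recip_gap x + recip_gap y" for x y
  define L where "L = {h x y / - d x y | x y. 0 < x \<and> 0 < y \<and> d x y < 0}"
  have sep: "h x y / - d x y \<le> - h x' y' / d x' y'"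
    if "0 < x" "0 < y" "d x y < 0" "0 < x'" "0 < y'" "0 < d x' y'" for x y x' y'
  proof -
    have "d x' y' * h x y - d x y * h x' y' \<le> 0"
      using four_point[OF assms, of x x' y y'] that by (simp add: h_def d_def)
    then have "h x y \<le> (- h x' y' * - d x y) / d x' y'"
      using that by (simp add: pos_le_divide_eq mult.commute)
    moreover have "0 < - d x y" using that by simp
    ultimately show ?thesis by (subst pos_divide_le_eq) auto
  qed
  \<comment> \<open>These two pairs show that \<open>L\<close> is nonempty and bounded
    above.\<close>
  have half: "d (1/2) (1/2) < 0" and two: "0 < d 2 2" by (auto simp: d_def recip_gap_def)
  have bdd: "bdd_above L"
    using sep[of _ _ 2 2] two unfolding L_def by (intro bdd_aboveI[of _ "- h 2 2 / d 2 2"]) auto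
  have "L \<noteq> {}" unfolding L_def using half by (auto intro!: exI[of _ "1/2"])
  have "h x y + Sup L * d x y \<le> 0" if "0 < x" "0 < y" for x y
  proof (cases "d x y" "0 :: real" rule: linorder_cases)
    case less
    then have "h x y / - d x y \<le> Sup L" using bdd that by (intro cSup_upper) (auto simp: L_def)
    then show ?thesis using less by (simp add: field_simps)
  next
    case equal
    have "h x y \<le> 0"
    proof -
      have "y = 1 / x"
        using equal that recip_gap_inverse[of x] recip_gap_le_iff[of y "1 / x"] recip_gap_le_iff[of "1 / x" y]
        by (simp add: d_def)
      then show ?thesis
        using square_gap_le_1[of x y "M x" "N y"] that
          unit_slope.T_le[OF assms(1)] unit_slope.T_le[OF assms(2)]
          unit_slope.M_bounds[OF assms(1)] unit_slope.M_bounds[OF assms(2)]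
        by (smt (verit) h_def nonzero_mult_div_cancel_left times_divide_eq_right mult.right_neutral)
    qed
    then show ?thesis using equal by simp
  next
    case greater
    then have "Sup L \<le> - h x y / d x y" using sep that \<open>L \<noteq> {}\<close> by (intro cSup_least) (auto simp: L_def)
    then show ?thesis using greater by (simp add: field_simps)
  qed
  then show ?thesis using that unfolding h_def d_def by blast
qed

section \<open>The pointwise bound with both multipliers\<close>

lemma lipschitz_stein_bound:
  fixes f F :: "real \<Rightarrow> real"
  assumes lip: "\<And>x y. \<bar>f x - f y\<bar> \<le> \<bar>x - y\<bar>" and "f 0 = 0" "F 0 = 0"
    and F: "\<And>x. (F has_real_derivative f x) (at x)"
  obtains a s where "\<And>w. f w - w * F w \<le> \<bar>w\<bar> ^ 3 / 2 + s * (w\<^sup>2 - 1) + a * w"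
proof -
  have lip_le: "f y - f x \<le> y - x" "f x - f y \<le> y - x" if "x \<le> y" for x y
    using lip[of x y] that by auto
  interpret M: unit_slope "\<lambda>t. (t + f t) / 2" "\<lambda>t. (t\<^sup>2 / 2 + F t) / 2"
  proof unfold_locales
    fix x y :: real
    assume "x \<le> y"
    then show "(x + f x) / 2 \<le> (y + f y) / 2" "(y + f y) / 2 \<le> (x + f x) / 2 + (y - x)"
      using lip_le[of x y] by (simp_all add: field_simps)
  qed (use assms in \<open>auto intro!: derivative_eq_intros F simp: field_simps\<close>)
  have F': "((\<lambda>t. F (- t)) has_real_derivative - f (- t)) (at t)" for t
    using DERIV_chain2[OF F[of "- t"] DERIV_minus[OF DERIV_ident]] by simp
  interpret N: unit_slope "\<lambda>t. (t + f (- t)) / 2" "\<lambda>t. (t\<^sup>2 / 2 - F (- t)) / 2"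
  proof unfold_locales
    fix x y :: real
    assume "x \<le> y"
    then show "(x + f (- x)) / 2 \<le> (y + f (- y)) / 2"
        "(y + f (- y)) / 2 \<le> (x + f (- x)) / 2 + (y - x)"
      using lip_le[of "- y" "- x"] by (simp_all add: field_simps)
  qed (use assms in \<open>auto intro!: derivative_eq_intros F' simp: field_simps\<close>)
  obtain s where s: "\<And>x y. 0 < x \<Longrightarrow> 0 < y \<Longrightarrow> M.T x + N.T y - 1 + s * (recip_gap x + recip_gap y) \<le> 0"
    using multiplier_exists[OF M.unit_slope_axioms N.unit_slope_axioms] by blast
  define R where "R x = M.T x + s * recip_gap x" for x
  \<comment> \<open>Given \<open>s\<close>, the inequality separates into a function of
    \<open>x\<close> lying below a function of \<open>y\<close>. Any number between them, such as
    this supremum, yields the multiplier of the mean constraint.\<close>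
  define A where "A = (SUP x\<in>{0<..}. R x)"
  have R_le: "R x \<le> 1 - N.T y - s * recip_gap y" if "0 < x" "0 < y" for x y
    using s[OF that] by (simp add: R_def algebra_simps)
  have "bdd_above (R ` {0<..})"
    using R_le[of _ 1] by (intro bdd_aboveI2) auto
  then have up: "R x \<le> A" if "0 < x" for x
    unfolding A_def using that by (intro cSUP_upper) auto
  have low: "A \<le> 1 - N.T y - s * recip_gap y" if "0 < y" for y
    unfolding A_def using R_le that by (intro cSUP_least) auto
  \<comment> \<open>Multiplying the separated inequalities by \<open>2 * \<bar>w\<bar>\<close>
    recovers the claim, whence the multipliers \<open>- 2 * s\<close> and
    \<open>2 * A - 1\<close>.\<close>
  define L where "L w = f w - w * F w - (\<bar>w\<bar> ^ 3 / 2 + (- 2 * s) * (w\<^sup>2 - 1) + (2 * A - 1) * w)" for w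
  have T_eqs: "M.T x = (x + f x) / 2 / x - (x\<^sup>2 / 2 + F x) / 2"
      "N.T x = (x + f (- x)) / 2 / x - (x\<^sup>2 / 2 - F (- x)) / 2" for x
    by (rule M.T_def N.T_def)+
  have nonzero: "L w \<le> 0" if "w \<noteq> 0" for w
  proof (cases "0 < w")
    case True
    have "2 * w * (R w - A) = L w"
      unfolding L_def R_def T_eqs recip_gap_def
      using True by (simp add: field_simps power2_eq_square power3_eq_cube)
    then show ?thesis using up[OF True] True by (smt (verit) mult_nonneg_nonpos)
  next
    case False
    define y where "y = - w"
    have y: "0 < y" "w = - y" using False that by (auto simp: y_def)
    have "2 * y * (A - (1 - N.T y - s * recip_gap y)) = L w"
      unfolding L_def T_eqs recip_gap_def
      using y by (simp add: field_simps power2_eq_square power3_eq_cube)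
    then show ?thesis using low[OF y(1)] y by (smt (verit) mult_nonneg_nonpos)
  qed
  \<comment> \<open>The point \<open>w = 0\<close>, lost by the division, is recovered by
    continuity.\<close>
  have "1-lipschitz_on UNIV f" using lip by (auto intro!: lipschitz_onI simp: dist_real_def)
  then have "isCont f 0"
    using lipschitz_on_continuous_on continuous_on_eq_continuous_at open_UNIV UNIV_I by blast
  moreover have "isCont F 0" using F DERIV_isCont by blast
  ultimately have "isCont L 0" unfolding L_def by (intro continuous_intros) auto
  then have "L 0 \<le> 0"
    by (intro tendsto_upperbound[of L "L 0" "at 0"])
       (auto simp: isCont_def eventually_at_filter nonzero)
  with nonzero have "L w \<le> 0" for w by (cases "w = 0") auto
  then show ?thesis unfolding L_def diff_le_0_iff_le by (rule that)
qed

section \<open>From zero biasing to the upper bound\<close>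

lemma antiderivative_exists:
  fixes f :: "real \<Rightarrow> real"
  assumes "continuous_on UNIV f"
  obtains F where "F 0 = 0" "\<And>x. (F has_real_derivative f x) (at x)"
proof -
  have "\<exists>F. \<forall>x::real. -\<infinity> < ereal x \<longrightarrow> ereal x < \<infinity> \<longrightarrow> (F has_vector_derivative f x) (at x)"
    using assms by (intro einterval_antiderivative) (auto simp: continuous_on_eq_continuous_at)
  then obtain F where "\<And>x. (F has_real_derivative f x) (at x)"
    by (auto simp: has_real_derivative_iff_has_vector_derivative)
  then show ?thesis
    by (intro that[of "\<lambda>x. F x - F 0"]) (auto intro!: derivative_eq_intros)
qed

lemma F1_D:
  assumes "f \<in> F1"
  shows "\<bar>f x - f y\<bar> \<le> \<bar>x - y\<bar>" "bounded (range f)" "continuous_on UNIV f"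
proof -
  have M1: "M1 f \<le> 1" and "bounded (range f)" using assms by (auto simp: F1_def)
  then show "bounded (range f)" "continuous_on UNIV f" by (auto simp: M1_def split: if_splits)
  show "\<bar>f x - f y\<bar> \<le> \<bar>x - y\<bar>"
  proof (cases "x = y")
    case False
    have "ereal \<bar>(f x - f y) / (x - y)\<bar> \<le> M1 f"
      unfolding M1_def using False \<open>continuous_on UNIV f\<close>
      by (auto intro!: SUP_upper2[of "(x, y)"])
    with M1 have "\<bar>(f x - f y) / (x - y)\<bar> \<le> 1" by (metis ereal_less_eq(3) one_ereal_def order_trans)
    then show ?thesis using False by (simp add: abs_divide divide_le_eq_1)
  qed simp
qed

text \<open>As \<open>f\<close> is bounded, \<open>F\<close> grows at most linearly and
  \<open>W * F W\<close> is dominated by a multiple of \<open>W^2\<close>. Hence both integrability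
  premises of zero biasing hold for \<open>F\<close>.\<close>

lemma zero_biased_antiderivative:
  assumes zb: "zero_biased M W N V" and var: "(LINT x|M. (W x)\<^sup>2) = 1"
    and f: "continuous_on UNIV f" "bounded (range f)"
    and F: "F 0 = 0" "\<And>x. (F has_real_derivative f x) (at x)"
  shows "integrable M (\<lambda>x. W x * F (W x))" "(LINT x|M. W x * F (W x)) = (LINT y|N. f (V y))"
proof -
  have meas: "W \<in> borel_measurable M" "V \<in> borel_measurable N"
    and W2: "integrable M (\<lambda>x. (W x)\<^sup>2)" and N: "prob_space N"
    and *: "\<And>f. f differentiable_on UNIV \<Longrightarrow> integrable M (\<lambda>x. W x * f (W x)) \<Longrightarrow>
       integrable N (\<lambda>y. deriv f (V y)) \<Longrightarrow>
       (LINT x|M. W x * f (W x)) = (LINT x|M. (W x)\<^sup>2) * (LINT y|N. deriv f (V y))"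
    using zb by (auto simp: zero_biased_def)
  interpret N: prob_space N by fact
  have [measurable]: "f \<in> borel_measurable borel" using f(1) by (rule borel_measurable_continuous_onI)
  have "continuous_on UNIV F" using F(2) DERIV_isCont continuous_at_imp_continuous_on by blast
  then have [measurable]: "F \<in> borel_measurable borel" by (rule borel_measurable_continuous_onI)
  note meas[measurable]
  obtain B where B: "\<And>x. \<bar>f x\<bar> \<le> B" using f(2) by (auto simp: bounded_iff)
  have FB: "\<bar>F w\<bar> \<le> B * \<bar>w\<bar>" for w
    using field_differentiable_bound[of UNIV F f B w 0] F B by auto
  show int: "integrable M (\<lambda>x. W x * F (W x))"
  proof (rule Bochner_Integration.integrable_bound)
    show "integrable M (\<lambda>x. B * (W x)\<^sup>2)" using W2 by simp
    have "\<bar>w * F w\<bar> \<le> B * w\<^sup>2" for w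
      using mult_left_mono[OF FB[of w], of "\<bar>w\<bar>"] by (simp add: abs_mult power2_eq_square algebra_simps)
    then show "AE x in M. norm (W x * F (W x)) \<le> norm (B * (W x)\<^sup>2)"
      by (intro AE_I2) (smt (verit) real_norm_def)
  qed measurable
  have deriv: "deriv F = f" using F(2) DERIV_imp_deriv by blast
  have "F differentiable_on UNIV"
    using F(2) by (auto simp: differentiable_on_def differentiable_def has_field_derivative_def)
  moreover have "integrable N (\<lambda>y. f (V y))"
    using B by (intro N.integrable_const_bound[of _ B]) auto
  ultimately show "(LINT x|M. W x * F (W x)) = (LINT y|N. f (V y))"
    using *[of F] int by (simp add: deriv var)
qed

text \<open>On integrating the pointwise bound, the terms with \<open>s\<close> and \<open>a\<close>
  vanish because \<open>W\<close> has variance one and mean zero.\<close>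

lemma zero_biased_expectation_diff_le:
  assumes zb: "zero_biased M W N V" and var: "(LINT x|M. (W x)\<^sup>2) = 1"
    and W3: "integrable M (\<lambda>x. \<bar>W x\<bar> ^ 3)"
    and lip: "\<And>x y. \<bar>f x - f y\<bar> \<le> \<bar>x - y\<bar>" and f: "bounded (range f)" "continuous_on UNIV f"
  shows "(LINT x|M. f (W x)) - (LINT y|N. f (V y)) \<le> 1 / 2 * (LINT x|M. \<bar>W x\<bar> ^ 3)"
proof -
  have meas: "W \<in> borel_measurable M" "V \<in> borel_measurable N"
    and W2: "integrable M (\<lambda>x. (W x)\<^sup>2)" and mean: "(LINT x|M. W x) = 0"
    and "prob_space M" "prob_space N"
    using zb by (auto simp: zero_biased_def)
  interpret M: prob_space M by fact
  interpret N: prob_space N by fact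
  note meas[measurable]
  have W1: "integrable M W" using M.square_integrable_imp_integrable W2 meas by blast
  have [measurable]: "f \<in> borel_measurable borel" using f(2) by (rule borel_measurable_continuous_onI)
  obtain B where B: "\<And>x. \<bar>f x\<bar> \<le> B" using f(1) by (auto simp: bounded_iff)
  have fW: "integrable M (\<lambda>x. f (W x))" and fV: "integrable N (\<lambda>y. f (V y))"
    using B by (auto intro!: M.integrable_const_bound[of _ B] N.integrable_const_bound[of _ B])
  \<comment> \<open>The pointwise bound needs a function vanishing at \<open>0\<close>; the shift
    does not change the difference of expectations.\<close>
  define g where "g x = f x - f 0" for x
  have g: "continuous_on UNIV g" "bounded (range g)"
  proof -
    show "continuous_on UNIV g" unfolding g_def by (intro continuous_intros f)
    have "\<bar>g x\<bar> \<le> B + B" for x using B[of x] B[of 0] unfolding g_def by linarith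
    then show "bounded (range g)" by (auto simp: bounded_iff)
  qed
  obtain F where F: "F 0 = 0" "\<And>x. (F has_real_derivative g x) (at x)"
    using antiderivative_exists[OF g(1)] by blast
  note zbF = zero_biased_antiderivative[OF zb var g F]
  obtain a s where as: "\<And>w. g w - w * F w \<le> \<bar>w\<bar> ^ 3 / 2 + s * (w\<^sup>2 - 1) + a * w"
    by (rule lipschitz_stein_bound[of g F]) (use lip F in \<open>auto simp: g_def\<close>)
  have "(LINT x|M. g (W x) - W x * F (W x)) \<le> (LINT x|M. \<bar>W x\<bar> ^ 3 / 2 + s * ((W x)\<^sup>2 - 1) + a * W x)"
    using fW zbF(1) W1 W2 W3 as by (intro integral_mono) (auto simp: g_def)
  moreover have "(LINT x|M. g (W x) - W x * F (W x)) = (LINT x|M. f (W x)) - f 0 - (LINT y|N. f (V y) - f 0)"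
    using fW zbF by (simp add: g_def M.prob_space)
  moreover have "(LINT y|N. f (V y) - f 0) = (LINT y|N. f (V y)) - f 0"
    using fV by (simp add: N.prob_space)
  moreover have "(LINT x|M. \<bar>W x\<bar> ^ 3 / 2 + s * ((W x)\<^sup>2 - 1) + a * W x) = 1 / 2 * (LINT x|M. \<bar>W x\<bar> ^ 3)"
    using W1 W2 W3 by (simp add: mean var M.prob_space)
  ultimately show ?thesis by simp
qed

lemma zeta1_zero_biased_le:
  assumes zb: "zero_biased M W N V" and "(LINT x|M. (W x)\<^sup>2) = 1"
    and "integrable M (\<lambda>x. \<bar>W x\<bar> ^ 3)"
  shows "zeta1 M W N V \<le> ereal (1 / 2 * (LINT x|M. \<bar>W x\<bar> ^ 3))"
  unfolding zeta1_def
proof (rule SUP_least)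
  fix f assume f: "f \<in> F1"
  \<comment> \<open>Applying the one-sided bound to \<open>- f\<close> as well gives the absolute
    value.\<close>
  have "(LINT x|M. - f (W x)) - (LINT y|N. - f (V y)) \<le> 1 / 2 * (LINT x|M. \<bar>W x\<bar> ^ 3)"
    using F1_D[OF f]
    by (intro zero_biased_expectation_diff_le assms)
       (auto intro: continuous_intros simp: abs_minus_commute bounded_iff)
  moreover have "(LINT x|M. f (W x)) - (LINT y|N. f (V y)) \<le> 1 / 2 * (LINT x|M. \<bar>W x\<bar> ^ 3)"
    using F1_D[OF f] by (intro zero_biased_expectation_diff_le assms) auto
  ultimately show "ereal \<bar>(LINT x|M. f (W x)) - (LINT y|N. f (V y))\<bar> \<le> ereal (1 / 2 * (LINT x|M. \<bar>W x\<bar> ^ 3))"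
    unfolding ereal_less_eq(3) abs_le_iff by simp
qed

section \<open>Two-point laws and equality\<close>

text \<open>Total mass and the first two moments determine the product of the atoms and then both
  masses. The atoms have opposite signs; the positive one is named \<open>a\<close>, the negative
  one \<open>- b\<close>.\<close>

lemma two_point_standardized:
  assumes "prob_space M" "W \<in> borel_measurable M" "two_point_distribution M W"
    and mean: "(LINT x|M. W x) = 0" and var: "(LINT x|M. (W x)\<^sup>2) = 1"
  obtains a b where "0 < a" "0 < b" "a * b = 1"
    "\<And>h :: real \<Rightarrow> real. h \<in> borel_measurable borel \<Longrightarrow> (LINT x|M. h (W x)) = (b * h a + a * h (- b)) / (a + b)"
proof -
  interpret prob_space M by fact
  obtain a b where ab: "a \<noteq> b" and AE: "AE x in M. W x = a \<or> W x = b"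
    using assms(3) by (auto simp: two_point_distribution_def)
  note assms(2)[measurable]
  define p where "p = measure M {x \<in> space M. W x = a}"
  define q where "q = measure M {x \<in> space M. W x = b}"
  have exp: "(LINT x|M. h (W x)) = p * h a + q * h b"
    if [measurable]: "h \<in> borel_measurable borel" for h :: "real \<Rightarrow> real"
  proof -
    have "(LINT x|M. h (W x)) = (LINT x|M. h a * indicator {x \<in> space M. W x = a} x
        + h b * indicator {x \<in> space M. W x = b} x)"
    proof (rule integral_cong_AE)
      show "AE x in M. h (W x) = h a * indicator {x \<in> space M. W x = a} x
          + h b * indicator {x \<in> space M. W x = b} x"
        using AE AE_space by eventually_elim (use ab in \<open>auto simp: indicator_def\<close>)
    qed measurable
    also have "\<dots> = p * h a + q * h b"
    proof -
      have "integrable M (\<lambda>x. c * indicator {x \<in> space M. W x = t} x)" for c t :: real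
        by (intro integrable_mult_right integrable_real_indicator) (auto simp: less_top[symmetric])
      then show ?thesis by (simp add: p_def q_def)
    qed
    finally show ?thesis .
  qed
  have pq: "p + q = 1" using exp[of "\<lambda>_. 1"] by (simp add: prob_space)
  have m1: "p * a + q * b = 0" using exp[of "\<lambda>x. x"] mean by simp
  have m2: "p * a\<^sup>2 + q * b\<^sup>2 = 1" using exp[of "\<lambda>x. x\<^sup>2"] var by simp
  \<comment> \<open>This is the expectation of \<open>W^2 = (a + b) * W - a * b\<close>, which holds
    at both atoms.\<close>
  have "p * a\<^sup>2 + q * b\<^sup>2 = (p * a + q * b) * (a + b) - (p + q) * (a * b)"
    by (simp add: power2_eq_square algebra_simps)
  then have prod: "a * b = - 1" using pq m1 m2 by simp
  have "p * (a - b) = (p * a + q * b) - (p + q) * b" "q * (b - a) = (p * a + q * b) - (p + q) * a"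
    by (simp_all add: algebra_simps)
  then have "p * (a - b) = - b" "q * (b - a) = - a"
    unfolding pq m1 by simp_all
  then have pq_eq: "p = - b / (a - b)" "q = - a / (b - a)"
    using ab by (intro eq_divide_imp; simp)+
  show ?thesis
  proof (cases "0 < a")
    case True
    then have "b < 0" using prod by (smt (verit) mult_nonneg_nonneg)
    have "q = a / (a - b)" using pq_eq(2) by (metis minus_diff_eq minus_divide_divide)
    with exp pq_eq(1) have "(LINT x|M. h (W x)) = (- b * h a + a * h (- (- b))) / (a + - b)"
      if "h \<in> borel_measurable borel" for h :: "real \<Rightarrow> real"
      using that by (simp add: add_divide_distrib diff_divide_distrib)
    then show ?thesis using that[of a "- b"] True \<open>b < 0\<close> prod by auto
  next
    case False
    then have "a < 0" "0 < b" using prod by (cases "a = 0"; simp; smt (verit) mult_nonpos_nonpos)+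
    have "p = b / (b - a)" using pq_eq(1) by (metis minus_diff_eq minus_divide_divide)
    with exp pq_eq(2) have "(LINT x|M. h (W x)) = (- a * h b + b * h (- (- a))) / (b + - a)"
      if "h \<in> borel_measurable borel" for h :: "real \<Rightarrow> real"
      using that by (simp add: add_divide_distrib diff_divide_distrib)
    then show ?thesis using that[of b "- a"] \<open>a < 0\<close> \<open>0 < b\<close> prod by (auto simp: mult.commute)
  qed
qed

text \<open>The test function swaps the sizes of the atoms, \<open>f a = b\<close> and
  \<open>f (- b) = a\<close>, so its mean under \<open>W\<close> is the third absolute moment. Its
  mean under \<open>V\<close>, computed from \<open>F\<close> at the two atoms, is half of
  that.\<close>

lemma zeta1_two_point_ge:
  assumes zb: "zero_biased M W N V" and var: "(LINT x|M. (W x)\<^sup>2) = 1"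
    and tp: "two_point_distribution M W"
  shows "ereal (1 / 2 * (LINT x|M. \<bar>W x\<bar> ^ 3)) \<le> zeta1 M W N V"
proof -
  have M: "prob_space M" "W \<in> borel_measurable M" "(LINT x|M. W x) = 0"
    using zb by (auto simp: zero_biased_def)
  obtain a b where ab: "0 < a" "0 < b" "a * b = 1"
    and E: "\<And>h :: real \<Rightarrow> real. h \<in> borel_measurable borel \<Longrightarrow> (LINT x|M. h (W x)) = (b * h a + a * h (- b)) / (a + b)"
    using two_point_standardized[OF M(1,2) tp M(3) var] by metis
  \<comment> \<open>The cutoff \<open>a + b\<close> only ensures boundedness: it is inactive on
    \<open>[- b, a]\<close>.\<close>
  define f where "f x = min \<bar>x - (a - b)\<bar> (a + b)" for x :: real
  have lip: "\<bar>f x - f y\<bar> \<le> \<bar>x - y\<bar>" for x y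
    unfolding f_def by linarith
  have cont: "continuous_on UNIV f" unfolding f_def by (intro continuous_intros)
  have "\<bar>f x\<bar> \<le> a + b" for x using ab unfolding f_def by linarith
  then have bdd: "bounded (range f)" by (auto simp: bounded_iff)
  have "M1 f \<le> 1"
    using lip cont by (auto simp: M1_def one_ereal_def abs_divide divide_le_eq_1 intro!: SUP_least)
  then have f: "f \<in> F1" using bdd by (simp add: F1_def)
  obtain F where F: "F 0 = 0" "\<And>x. (F has_real_derivative f x) (at x)"
    using antiderivative_exists[OF cont] by blast
  have [measurable]: "f \<in> borel_measurable borel" using cont by (rule borel_measurable_continuous_onI)
  have "continuous_on UNIV F" using F(2) DERIV_isCont continuous_at_imp_continuous_on by blast
  then have [measurable]: "F \<in> borel_measurable borel" by (rule borel_measurable_continuous_onI)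
  have F_cont: "continuous_on S F" for S
    using \<open>continuous_on UNIV F\<close> continuous_on_subset by blast
  \<comment> \<open>On each side of the kink \<open>a - b\<close>, \<open>F\<close> differs from a
    quadratic by a constant; joining both pieces gives \<open>F a - F (- b)\<close>.\<close>
  have "F (a - b) + (a - b - (a - b))\<^sup>2 / 2 = F (- b) + (- b - (a - b))\<^sup>2 / 2"
  proof (rule DERIV_isconst_end[of "- b" "a - b" "\<lambda>x. F x + (x - (a - b))\<^sup>2 / 2"])
    fix x assume "- b < x" "x < a - b"
    then have "f x = a - b - x" using ab by (auto simp: f_def)
    then show "((\<lambda>x. F x + (x - (a - b))\<^sup>2 / 2) has_real_derivative 0) (at x)"
      using F(2)[of x] by (auto intro!: derivative_eq_intros simp: diff_divide_distrib)
  qed (use ab in \<open>auto intro!: continuous_intros F_cont\<close>)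
  moreover have "F a - (a - (a - b))\<^sup>2 / 2 = F (a - b) - (a - b - (a - b))\<^sup>2 / 2"
  proof (rule DERIV_isconst_end[of "a - b" a "\<lambda>x. F x - (x - (a - b))\<^sup>2 / 2"])
    fix x assume "a - b < x" "x < a"
    then have "f x = x - (a - b)" using ab by (auto simp: f_def)
    then show "((\<lambda>x. F x - (x - (a - b))\<^sup>2 / 2) has_real_derivative 0) (at x)"
      using F(2)[of x] by (auto intro!: derivative_eq_intros simp: diff_divide_distrib)
  qed (use ab in \<open>auto intro!: continuous_intros F_cont\<close>)
  ultimately have F_diff: "F a - F (- b) = (a\<^sup>2 + b\<^sup>2) / 2" by (simp add: field_simps)
  have "(LINT y|N. f (V y)) = (b * (a * F a) + a * (- b * F (- b))) / (a + b)"
    using zero_biased_antiderivative(2)[OF zb var cont bdd F] E[of "\<lambda>w. w * F w"] by simp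
  also have "b * (a * F a) + a * (- b * F (- b)) = (a * b) * (F a - F (- b))"
    by (simp add: algebra_simps)
  finally have V: "(LINT y|N. f (V y)) = (a\<^sup>2 + b\<^sup>2) / (a + b) / 2"
    by (simp add: F_diff ab)
  have "f a = b" "f (- b) = a" using ab by (auto simp: f_def)
  then have W: "(LINT x|M. f (W x)) = (a\<^sup>2 + b\<^sup>2) / (a + b)"
    using E[of f] by (simp add: power2_eq_square algebra_simps)
  have "b * \<bar>a\<bar> ^ 3 + a * \<bar>- b\<bar> ^ 3 = (a * b) * (a\<^sup>2 + b\<^sup>2)"
    using ab by (simp add: power2_eq_square power3_eq_cube algebra_simps)
  then have W3: "(LINT x|M. \<bar>W x\<bar> ^ 3) = (a\<^sup>2 + b\<^sup>2) / (a + b)"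
    using E[of "\<lambda>w. \<bar>w\<bar> ^ 3"] ab by simp
  have "1 / 2 * (LINT x|M. \<bar>W x\<bar> ^ 3) = (LINT x|M. f (W x)) - (LINT y|N. f (V y))"
  proof -
    have "1 / 2 * r = r - r / 2" for r :: real by simp
    then show ?thesis unfolding V W W3 .
  qed
  also have "\<dots> \<le> \<bar>(LINT x|M. f (W x)) - (LINT y|N. f (V y))\<bar>" by simp
  finally show ?thesis
    unfolding zeta1_def using f by (intro SUP_upper2[of f]) auto
qed

theorem theorem3:
  fixes M :: "'a measure" and N :: "'b measure"
    and W :: "'a \<Rightarrow> real" and Wstar :: "'b \<Rightarrow> real"
  assumes "prob_space M" and "W \<in> borel_measurable M"
    and "(LINT x|M. W x) = 0"
    and "(LINT x|M. (W x)\<^sup>2) = 1"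
    and "integrable M (\<lambda>x. \<bar>W x\<bar> ^ 3)"
    and "prob_space N" and "Wstar \<in> borel_measurable N"
    and "zero_biased M W N Wstar"
  shows "zeta1 M W N Wstar \<le> ereal (1 / 2 * (LINT x|M. \<bar>W x\<bar> ^ 3)) \<and>
    (two_point_distribution M W \<longrightarrow>
       zeta1 M W N Wstar = ereal (1 / 2 * (LINT x|M. \<bar>W x\<bar> ^ 3)))"
  using zeta1_zero_biased_le[OF assms(8,4,5)] zeta1_two_point_ge[OF assms(8,4)]
  by (auto intro: antisym)

end
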